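(* There are no continuous inverse ambiguous functions defined on the orthogonal group $O(2)$, and there are no continuous inverse ambiguous functions defined on the special orthogonal group $SO(2)$.
   Context: For a group $G$, a function $f : G \to G$ is called inverse ambiguous if it is bijective and its inverse function satisfies $f^{-1}(x) = (f(x))^{-1}$ for all $x \in G$, where the right-hand side is the group inverse of $f(x)$. Equivalently, $f(f(x)) = x^{-1}$ for all $x \in G$. $O(2) = \{A \in GL_2(\mathbb{R}) : AA^T = I_2\}$ and $SO(2) = \{A \in O(2) : \det A = 1\}$ are topological groups under matrix multiplication with the subspace topology from the real $2 \times 2$ matrices. *)

theory Defs
  imports "HOL-Analysis.Analysis" "HOL-Algebra.Group"
begin

text \<open>Functions \<open>G \<rightarrow> G\<close> are total HOL functions of which only the values on
  \<open>carrier G\<close> matter; accordingly the inverse function is the inverse on the carrier.\<close>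

definition inverse_ambiguous :: "('a, 'b) monoid_scheme \<Rightarrow> ('a \<Rightarrow> 'a) \<Rightarrow> bool" where
  "inverse_ambiguous G f \<longleftrightarrow>
     bij_betw f (carrier G) (carrier G) \<and>
     (\<forall>x\<in>carrier G. inv_into (carrier G) f x = inv\<^bsub>G\<^esub> (f x))"

definition orthogonal_group :: "(real^'n^'n) monoid" where
  "orthogonal_group = \<lparr>carrier = {A. orthogonal_matrix A}, mult = (**), one = mat 1\<rparr>"

definition special_orthogonal_group :: "(real^'n^'n) monoid" where
  "special_orthogonal_group =
     \<lparr>carrier = {A. orthogonal_matrix A \<and> det A = 1}, mult = (**), one = mat 1\<rparr>"

lemma carrier_orthogonal_group:
  "carrier orthogonal_group = {A :: real^'n^'n. invertible A \<and> A ** transpose A = mat 1}"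
  by (auto simp: orthogonal_group_def orthogonal_matrix_def invertible_def
      matrix_left_right_inverse)

lemma carrier_special_orthogonal_group:
  "carrier special_orthogonal_group =
     {A :: real^'n^'n. A \<in> carrier orthogonal_group \<and> det A = 1}"
  by (simp add: special_orthogonal_group_def orthogonal_group_def)

lemma group_orthogonal_group: "group (orthogonal_group :: (real^'n^'n) monoid)"
proof (rule groupI)
  fix A :: "real^'n^'n"
  assume "A \<in> carrier orthogonal_group"
  then show "\<exists>B\<in>carrier orthogonal_group. B \<otimes>\<^bsub>orthogonal_group\<^esub> A = \<one>\<^bsub>orthogonal_group\<^esub>"
    by (intro bexI[of _ "transpose A"])
       (auto simp: orthogonal_group_def orthogonal_matrix_def)
qed (auto simp: orthogonal_group_def orthogonal_matrix_mul orthogonal_matrix_id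
       matrix_mul_assoc)

lemma group_special_orthogonal_group: "group (special_orthogonal_group :: (real^'n^'n) monoid)"
proof (rule groupI)
  fix A :: "real^'n^'n"
  assume "A \<in> carrier special_orthogonal_group"
  then show "\<exists>B\<in>carrier special_orthogonal_group. B \<otimes>\<^bsub>special_orthogonal_group\<^esub> A = \<one>\<^bsub>special_orthogonal_group\<^esub>"
    by (intro bexI[of _ "transpose A"])
       (auto simp: special_orthogonal_group_def orthogonal_matrix_def)
qed (auto simp: special_orthogonal_group_def orthogonal_matrix_mul orthogonal_matrix_id
       matrix_mul_assoc det_mul)

lemma (in group) inverse_ambiguous_iff:
  "inverse_ambiguous G f \<longleftrightarrow>
     f \<in> carrier G \<rightarrow> carrier G \<and> (\<forall>x\<in>carrier G. f (f x) = inv x)"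
proof
  assume *: "inverse_ambiguous G f"
  then have b: "bij_betw f (carrier G) (carrier G)"
    and e: "\<And>x. x \<in> carrier G \<Longrightarrow> inv_into (carrier G) f x = inv (f x)"
    by (auto simp: inverse_ambiguous_def)
  have m: "f x \<in> carrier G" if "x \<in> carrier G" for x
    using b that by (auto simp: bij_betw_def)
  have "f (f x) = inv x" if x: "x \<in> carrier G" for x
    using e[OF m[OF x]] m[OF m[OF x]] x b
    by (metis bij_betw_inv_into_left inv_inv)
  with m show "f \<in> carrier G \<rightarrow> carrier G \<and> (\<forall>x\<in>carrier G. f (f x) = inv x)" by auto
next
  assume "f \<in> carrier G \<rightarrow> carrier G \<and> (\<forall>x\<in>carrier G. f (f x) = inv x)"
  then have m: "\<And>x. x \<in> carrier G \<Longrightarrow> f x \<in> carrier G"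
    and e: "\<And>x. x \<in> carrier G \<Longrightarrow> f (f x) = inv x" by auto
  have i: "inj_on f (carrier G)"
    by (rule inj_onI) (metis e inv_inv)
  have r: "f (inv (f x)) = x" if x: "x \<in> carrier G" for x
    by (metis e m inv_inv x)
  have "f ` carrier G = carrier G"
    using m r by (auto intro!: image_eqI[of _ f "inv (f _)"])
  with i m r show "inverse_ambiguous G f"
    unfolding inverse_ambiguous_def bij_betw_def
    by (auto intro!: inv_into_f_eq)
qed

end

theory Submission
  imports Defs
begin

text \<open>An inverse ambiguous \<open>f\<close> commutes with inversion, so it permutes the elements that differ
  from their inverse. In \<open>O(2)\<close> and in \<open>SO(2)\<close> these are the rotations with nonzero sine, which
  form two arcs exchanged by inversion. A continuous \<open>f\<close> either preserves or exchanges the arcs,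
  so \<open>f \<circ> f\<close> preserves them, whereas \<open>f \<circ> f\<close> is inversion.\<close>

context group
begin

text \<open>Both sides equal \<open>f (f (f x))\<close>.\<close>

lemma inverse_ambiguous_inv:
  assumes "inverse_ambiguous G f" "x \<in> carrier G"
  shows "f (inv x) = inv (f x)"
proof -
  have "f \<in> carrier G \<rightarrow> carrier G" "\<And>y. y \<in> carrier G \<Longrightarrow> f (f y) = inv y"
    using assms(1) by (auto simp: inverse_ambiguous_iff)
  then show ?thesis
    using assms(2) by (metis funcset_mem)
qed

text \<open>Since \<open>f\<close> commutes with inversion, the left equation reads
  \<open>f x = f (inv x)\<close>, and injectivity cancels \<open>f\<close>.\<close>

lemma inverse_ambiguous_eq_inv_iff:
  assumes "inverse_ambiguous G f" "x \<in> carrier G"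
  shows "f x = inv (f x) \<longleftrightarrow> x = inv x"
proof -
  have "inj_on f (carrier G)"
    using assms(1) by (simp add: inverse_ambiguous_def bij_betw_def)
  then have "f x = f (inv x) \<longleftrightarrow> x = inv x"
    using assms(2) by (simp add: inj_on_eq_iff)
  then show ?thesis
    using assms by (simp add: inverse_ambiguous_inv)
qed

end

lemma inv_orthogonal_group:
  assumes "A \<in> carrier orthogonal_group"
  shows "inv\<^bsub>orthogonal_group\<^esub> A = transpose A"
  by (rule group.inv_equality[OF group_orthogonal_group])
     (use assms in \<open>auto simp: orthogonal_group_def orthogonal_matrix_def\<close>)

lemma inv_special_orthogonal_group:
  assumes "A \<in> carrier special_orthogonal_group"
  shows "inv\<^bsub>special_orthogonal_group\<^esub> A = transpose A"
  by (rule group.inv_equality[OF group_special_orthogonal_group])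
     (use assms in \<open>auto simp: special_orthogonal_group_def orthogonal_matrix_def\<close>)

text \<open>The matrix of multiplication by the complex number a + bi. Cosine and sine replace the
  angle, so the two arcs are told apart by the sign of \<open>b\<close>.\<close>

definition rotation_matrix :: "real \<Rightarrow> real \<Rightarrow> real^2^2" where
  "rotation_matrix a b = (\<chi> i j. if i = j then a else if i = 1 then - b else b)"

lemma rotation_matrix_nth [simp]:
  "rotation_matrix a b $ 1 $ 1 = a" "rotation_matrix a b $ 1 $ 2 = - b"
  "rotation_matrix a b $ 2 $ 1 = b" "rotation_matrix a b $ 2 $ 2 = a"
  by (simp_all add: rotation_matrix_def)

lemma transpose_rotation_matrix: "transpose (rotation_matrix a b) = rotation_matrix a (- b)"
  by (simp add: vec_eq_iff forall_2 transpose_def)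

lemma orthogonal_rotation_matrix:
  "orthogonal_matrix (rotation_matrix a b) \<longleftrightarrow> a\<^sup>2 + b\<^sup>2 = 1"
  by (auto simp: orthogonal_matrix vec_eq_iff forall_2 matrix_matrix_mult_def transpose_def
      sum_2 mat_def power2_eq_square)

lemma det_rotation_matrix: "det (rotation_matrix a b) = a\<^sup>2 + b\<^sup>2"
  by (simp add: det_2 power2_eq_square)

text \<open>Transposition is inversion here, so these are the elements that differ from their
  inverse. Reflections are symmetric, which leaves only rotations.\<close>

lemma orthogonal_asymmetric_iff:
  fixes A :: "real^2^2"
  shows "orthogonal_matrix A \<and> A \<noteq> transpose A \<longleftrightarrow>
    (\<exists>a b. A = rotation_matrix a b \<and> a\<^sup>2 + b\<^sup>2 = 1 \<and> b \<noteq> 0)"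
proof (intro iffI conjI)
  assume *: "orthogonal_matrix A \<and> A \<noteq> transpose A"
  define a b c d where "a = A$1$1" "b = A$2$1" "c = A$1$2" "d = A$2$2"
  note abcd = this
  have bc: "b \<noteq> c"
    using * by (auto simp: vec_eq_iff forall_2 transpose_def abcd)
  have "transpose A ** A = mat 1" "A ** transpose A = mat 1"
    using * by (auto simp: orthogonal_matrix_def)
  then have e: "a*a + b*b = 1" "a*c + b*d = 0" "a*a + c*c = 1"
    "b*b + d*d = 1"
    by (auto simp: vec_eq_iff forall_2 transpose_def matrix_matrix_mult_def
      sum_2 mat_def abcd)
  \<comment> \<open>The first column and the first row both have norm 1.\<close>
  have "(b - c) * (b + c) = 0"
    using e by (simp add: algebra_simps)
  then have c: "c = - b"
    using bc by simp
  then have "b \<noteq> 0"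
    using bc by simp
  \<comment> \<open>This is the orthogonality \<open>a*c + b*d = 0\<close> after substituting
    \<open>c = - b\<close>.\<close>
  moreover have "b * (d - a) = 0"
    using e c by (simp add: algebra_simps)
  ultimately have d: "d = a" by simp
  have "A = rotation_matrix a b"
    using c d by (simp add: vec_eq_iff forall_2 abcd)
  then show "\<exists>a b. A = rotation_matrix a b \<and> a\<^sup>2 + b\<^sup>2 = 1 \<and> b \<noteq> 0"
    using e \<open>b \<noteq> 0\<close> by (auto simp: power2_eq_square)
next
  assume "\<exists>a b. A = rotation_matrix a b \<and> a\<^sup>2 + b\<^sup>2 = 1 \<and> b \<noteq> 0"
  then obtain a b where A: "A = rotation_matrix a b" "a\<^sup>2 + b\<^sup>2 = 1" "b \<noteq> 0"
    by blast
  then show "orthogonal_matrix A"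
    by (simp add: orthogonal_rotation_matrix)
  show "A \<noteq> transpose A"
    using A by (metis transpose_rotation_matrix rotation_matrix_nth(3) neg_equal_zero)
qed

text \<open>The open upper half circle is the graph of a continuous function over an
  interval.\<close>

lemma connected_rotation_arc:
  "connected {rotation_matrix a b | a b. a\<^sup>2 + b\<^sup>2 = 1 \<and> b > 0}" (is "connected ?U")
proof -
  have "?U = (\<lambda>a. rotation_matrix a (sqrt (1 - a\<^sup>2))) ` {-1<..<1}"
  proof (intro equalityI subsetI)
    fix A assume "A \<in> ?U"
    then obtain a b where A: "A = rotation_matrix a b" "a\<^sup>2 + b\<^sup>2 = 1" "b > 0"
      by blast
    then have "b\<^sup>2 = 1 - a\<^sup>2"
      by simp
    then have "b = sqrt (1 - a\<^sup>2)"
      using A(3) by (metis less_imp_le real_sqrt_unique)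
    moreover have "a\<^sup>2 < 1"
      using A zero_less_power[of b 2] by linarith
    then have "a \<in> {-1<..<1}"
      by (auto simp: abs_square_less_1)
    ultimately show "A \<in> (\<lambda>a. rotation_matrix a (sqrt (1 - a\<^sup>2))) ` {-1<..<1}"
      using A(1) by blast
  next
    fix A assume "A \<in> (\<lambda>a. rotation_matrix a (sqrt (1 - a\<^sup>2))) ` {-1<..<1}"
    then obtain a where A: "A = rotation_matrix a (sqrt (1 - a\<^sup>2))" "\<bar>a\<bar> < 1"
      by auto
    then have "a\<^sup>2 < 1"
      by (simp add: abs_square_less_1)
    then show "A \<in> ?U"
      using A(1) by force
  qed
  moreover have "continuous_on {-1<..<1} (\<lambda>a. rotation_matrix a (sqrt (1 - a\<^sup>2)))"
    unfolding rotation_matrix_def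
  proof (intro continuous_on_vec_lambda)
    fix i j :: 2
    show "continuous_on {-1<..<1}
      (\<lambda>a. if i = j then a else if i = 1 then - sqrt (1 - a\<^sup>2) else sqrt (1 - a\<^sup>2))"
      by (cases "i = j"; cases "i = 1") (auto intro!: continuous_intros)
  qed
  ultimately show ?thesis
    by (simp add: connected_continuous_image)
qed

text \<open>The topological core, stated on \<open>N\<close> alone because \<open>O(2)\<close> and
  \<open>SO(2)\<close> share this set. The sign of the sine is multiplied by a constant
  \<open>e\<close> under \<open>f\<close>, hence by \<open>e * e = 1\<close> under
  \<open>f \<circ> f\<close>, while transposition negates it.\<close>

lemma no_continuous_square_root_of_transpose:
  fixes f :: "real^2^2 \<Rightarrow> real^2^2"
  defines "N \<equiv> {A. orthogonal_matrix A \<and> A \<noteq> transpose A}"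
  assumes cont: "continuous_on N f"
    and maps: "f \<in> N \<rightarrow> N"
    and square: "\<And>A. A \<in> N \<Longrightarrow> f (f A) = transpose A"
  shows False
proof -
  define s where "s = (\<lambda>A :: real^2^2. sgn (A $ 2 $ 1))"
  define U where "U = {rotation_matrix a b | a b. a\<^sup>2 + b\<^sup>2 = 1 \<and> b > 0}"
  have N: "N = {rotation_matrix a b | a b. a\<^sup>2 + b\<^sup>2 = 1 \<and> b \<noteq> 0}"
    unfolding N_def using orthogonal_asymmetric_iff by blast
  have UN: "U \<subseteq> N"
    by (auto simp: N U_def)
  have transpose_N: "transpose A \<in> N" if "A \<in> N" for A
    using that by (auto simp: N_def transpose_transpose)
  have s_transpose: "s (transpose A) = - s A" if "A \<in> N" for A
    using that by (auto simp: N s_def transpose_rotation_matrix sgn_minus)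
  have N_cases: "A \<in> U \<or> transpose A \<in> U" if "A \<in> N" for A
    using that by (auto simp: N U_def transpose_rotation_matrix)
      (metis linorder_neqE_linordered_idom neg_0_less_iff_less power2_minus)
  \<comment> \<open>Again both sides are \<open>f (f (f A))\<close>.\<close>
  have commute: "f (transpose A) = transpose (f A)" if "A \<in> N" for A
    using that square maps by (metis funcset_mem)
  have "connected ((\<lambda>A. f A $ 2 $ 1) ` U)"
  proof (rule connected_continuous_image)
    show "continuous_on U (\<lambda>A. f A $ 2 $ 1)"
      using continuous_on_subset[OF cont UN] by (intro continuous_on_component)
    show "connected U"
      unfolding U_def by (rule connected_rotation_arc)
  qed
  moreover have "f A $ 2 $ 1 \<noteq> 0" if "A \<in> N" for A
    using funcset_mem[OF maps that] by (auto simp: N)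
  then have "0 \<notin> (\<lambda>A. f A $ 2 $ 1) ` U"
    using UN by fastforce
  \<comment> \<open>A connected set of reals is an interval, and one that misses 0 lies on one side
    of it.\<close>
  ultimately have "(\<forall>A\<in>U. f A $ 2 $ 1 > 0) \<or> (\<forall>A\<in>U. f A $ 2 $ 1 < 0)"
    unfolding connected_iff_interval by (metis (no_types, lifting) imageI linorder_not_le less_imp_le)
  then have "(\<forall>A\<in>U. s (f A) = 1) \<or> (\<forall>A\<in>U. s (f A) = -1)"
    by (auto simp: s_def)
  \<comment> \<open>\<open>e\<close> is 1 if \<open>f\<close> preserves the arcs and -1 if it
    exchanges them; only its square matters below.\<close>
  then obtain e where e: "e * e = 1" "\<And>A. A \<in> U \<Longrightarrow> s (f A) = e"
    by (metis mult_1 square_eq_1_iff)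
  have s_U: "s A = 1" if "A \<in> U" for A
    using that by (auto simp: U_def s_def)
  \<comment> \<open>The lower arc is reduced to \<open>U\<close> by transposing, which commutes with
    \<open>f\<close> and negates \<open>s\<close>.\<close>
  have s_f: "s (f A) = e * s A" if A: "A \<in> N" for A
    using N_cases[OF A]
  proof
    assume U: "transpose A \<in> U"
    have "s (transpose (f A)) = e * s (transpose A)"
      using e(2)[OF U] s_U[OF U] commute[OF A] by simp
    then show ?thesis
      using A maps by (simp add: s_transpose funcset_mem)
  qed (use e s_U in simp)
  \<comment> \<open>The quarter turn serves as a sample point of \<open>U\<close>.\<close>
  define A where "A = rotation_matrix 0 1"
  have A: "A \<in> U"
    unfolding A_def U_def by force
  then have "A \<in> N" "f A \<in> N"
    using UN maps by auto
  then have "s (f (f A)) = s A"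
    using e s_f by (metis mult.assoc mult_1)
  then show False
    using \<open>A \<in> N\<close> s_U[OF A] square s_transpose by simp
qed

text \<open>The bounds \<open>sub\<close> and \<open>sup\<close> cover both groups at once: they
  make the asymmetric elements of \<open>G\<close> exactly the set \<open>N\<close> of the previous
  lemma.\<close>

lemma not_inverse_ambiguous_orthogonal:
  fixes G :: "(real^2^2) monoid"
  assumes "group G"
    and inv: "\<And>A. A \<in> carrier G \<Longrightarrow> inv\<^bsub>G\<^esub> A = transpose A"
    and sub: "carrier G \<subseteq> {A. orthogonal_matrix A}"
    and sup: "{A. orthogonal_matrix A \<and> A \<noteq> transpose A} \<subseteq> carrier G"
    and cont: "continuous_on (carrier G) f"
  shows "\<not> inverse_ambiguous G f"
proof
  interpret group G by fact
  assume f: "inverse_ambiguous G f"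
  then have maps: "f A \<in> carrier G" and square: "f (f A) = transpose A"
    if "A \<in> carrier G" for A
    using that by (auto simp: inverse_ambiguous_iff inv)
  have "f A \<noteq> transpose (f A)" if "A \<in> carrier G" "A \<noteq> transpose A" for A
    using that inverse_ambiguous_eq_inv_iff[OF f that(1)] maps inv by simp
  then show False
    using sub sup maps square
    by (intro no_continuous_square_root_of_transpose[OF continuous_on_subset[OF cont sup]])
      blast+
qed

theorem theorem5p4:
  shows "(\<nexists>f :: real^2^2 \<Rightarrow> real^2^2.
            continuous_on (carrier orthogonal_group) f \<and>
            inverse_ambiguous orthogonal_group f) \<and>
         (\<nexists>f :: real^2^2 \<Rightarrow> real^2^2.
            continuous_on (carrier special_orthogonal_group) f \<and>
            inverse_ambiguous special_orthogonal_group f)"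
proof -
  have "\<not> inverse_ambiguous orthogonal_group f"
    if "continuous_on (carrier orthogonal_group) f" for f :: "real^2^2 \<Rightarrow> real^2^2"
    by (rule not_inverse_ambiguous_orthogonal[OF group_orthogonal_group _ _ _ that])
      (auto simp: inv_orthogonal_group, auto simp: orthogonal_group_def)
  \<comment> \<open>Asymmetric orthogonal matrices are rotations and so have determinant 1.\<close>
  moreover have "{A :: real^2^2. orthogonal_matrix A \<and> A \<noteq> transpose A}
      \<subseteq> carrier special_orthogonal_group"
    unfolding orthogonal_asymmetric_iff
    by (auto simp: special_orthogonal_group_def orthogonal_rotation_matrix det_rotation_matrix)
  then have "\<not> inverse_ambiguous special_orthogonal_group f"
    if "continuous_on (carrier special_orthogonal_group) f" for f :: "real^2^2 \<Rightarrow> real^2^2"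
    using not_inverse_ambiguous_orthogonal[OF group_special_orthogonal_group _ _ _ that]
    by (simp add: inv_special_orthogonal_group) (auto simp: special_orthogonal_group_def)
  ultimately show ?thesis
    by blast
qed

end
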